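(* Fix $B<0$ and $\delta\in[0,1)$. For any stopping time $T\ge 1$, let $(b_t)_{t\in[T]}$ be a budget sequence such that (i) $b_t\ge B$ for all $t\in[T]$, and let $(\Delta_t)_{t\in[T]}$ be a risk tolerance sequence such that $\Delta_t\in[0,1)$ for all $t\in[T]$ and (ii) $1-\prod_{t=1}^T(1-\Delta_t)\le\delta$. Suppose the treatment groups $(\mathcal T_t)_{t\in[T]}$ are chosen such that (iii) for $t=1$: $\mathbb P(r_1\le b_1)\le\Delta_1$; and (iv) for any $t=2,\dots,T$, almost surely: $\mathcal T_t=\emptyset$ if $\mathbb P(R_{t-1}>B\mid\mathcal F_{t-1})=0$, and otherwise $$\mathbb P\left(R_t\le b_t\mid R_{t-1}>B,\mathcal F_{t-1}\right)\le\Delta_t .$$ Then $\mathbb P(R_T>B)\ge 1-\delta$. This inequality is tight (equality is attained) when the inequalities in (i), (ii), (iii) and (iv) are all equalities and $r_t\le0$ for all $t\in[T]$ almost surely. Furthermore, if we set $\mathcal T_t=\emptyset$, then the conditions in (iii) and (iv) always hold.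
   Context: Setting. At stages $t=1,\dots,T$ (where $T$ is not necessarily fixed) there is a set $\mathcal N_t$ of $N_t$ units. At stage $t$ the set $\mathcal N_t$ is randomly split into a treatment group $\mathcal T_t$, whose choice may depend on past observations, and a control group $\mathcal C_t=\mathcal N_t\setminus\mathcal T_t$; $W_{i,t}=1$ if $i\in\mathcal T_t$ and $W_{i,t}=0$ otherwise. Each unit $i\in\mathcal N_t$ has real-valued random potential outcomes $Y_{i,t}(0)$ (under control) and $Y_{i,t}(1)$ (under treatment); only $Y_{i,t}(W_{i,t})$ is observed. No assumption on the distribution of the outcomes is made. $\mathcal F_t$ is the $\sigma$-algebra generated by the treatment assignments $W_{i,k}$ ($k\le t$) and the observed outcomes $(Y_{i,k}(1))_{i\in\mathcal T_k}$, $(Y_{i,k}(0))_{i\in\mathcal C_k}$, $k\le t$; $\mathcal F_0$ is the trivial $\sigma$-algebra. The cost of stage $t$ is $r_t:=\sum_{i\in\mathcal T_t}\left(Y_{i,t}(1)-Y_{i,t}(0)\right)$, with $r_t=0$ if $\mathcal T_t=\emptyset$; the cumulative cost is $R_t:=\sum_{k=1}^t r_k$. (A negative value means adverse impact; $R_t$ is in general not $\mathcal F_t$-measurable.) $[T]=\{1,\dots,T\}$. The number of stages $T$ and the sequences $(b_t)$, $(\Delta_t)$ may be determined dynamically during the experiment ($b_t$ and $\Delta_t$ being defined just before stage $t$), and $T=+\infty$ is possible. $\mathbb P(\,\cdot\mid R_{t-1}>B,\mathcal F_{t-1})$ denotes the conditional probability given $\mathcal F_{t-1}$ and the event $\{R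_{t-1}>B\}$.
   Formalization: The "Furthermore" claim fails if b_1 ≥ 0 or B < R_{t-1} ≤ b_t; it is proved assuming b_1 < 0 for (iii), and b_t < R_{t-1} whenever R_{t-1} > B for (iv) (automatic when b_t = B). For T = ∞, R_T > B is read as R_n > B for all large n. *)

theory Defs
  imports "HOL-Probability.Probability" "HOL-Library.Extended_Nat"
begin

text \<open>
  Stages are numbered from 1. \<open>N t\<close> is the set of units at stage \<open>t\<close>, \<open>Tr t \<omega>\<close> the (random)
  treatment group, and \<open>Y i t w\<close> the potential outcome of unit \<open>i\<close> at stage \<open>t\<close> under control
  (\<open>w = 0\<close>) or treatment (\<open>w = 1\<close>). No independence and no distributional assumption is made.
\<close>

locale phased_experiment = prob_space M
  for M :: "'a measure" +
  fixes N :: "nat \<Rightarrow> 'i set"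
    and Tr :: "nat \<Rightarrow> 'a \<Rightarrow> 'i set"
    and Y :: "'i \<Rightarrow> nat \<Rightarrow> nat \<Rightarrow> 'a \<Rightarrow> real"
  assumes finite_units: "\<And>t. t \<ge> 1 \<Longrightarrow> finite (N t)"
    and treated_subset: "\<And>t \<omega>. t \<ge> 1 \<Longrightarrow> \<omega> \<in> space M \<Longrightarrow> Tr t \<omega> \<subseteq> N t"
    and treated_measurable: "\<And>t i. t \<ge> 1 \<Longrightarrow> i \<in> N t \<Longrightarrow> {\<omega> \<in> space M. i \<in> Tr t \<omega>} \<in> sets M"
    and outcome_measurable:
      "\<And>t i w. t \<ge> 1 \<Longrightarrow> i \<in> N t \<Longrightarrow> w \<in> {0, 1} \<Longrightarrow> Y i t w \<in> borel_measurable M"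

definition assignment :: "(nat \<Rightarrow> 'a \<Rightarrow> 'i set) \<Rightarrow> 'i \<Rightarrow> nat \<Rightarrow> 'a \<Rightarrow> nat" where
  "assignment Tr i t \<omega> = (if i \<in> Tr t \<omega> then 1 else 0)"

definition observed ::
  "(nat \<Rightarrow> 'a \<Rightarrow> 'i set) \<Rightarrow> ('i \<Rightarrow> nat \<Rightarrow> nat \<Rightarrow> 'a \<Rightarrow> real) \<Rightarrow> 'i \<Rightarrow> nat \<Rightarrow> 'a \<Rightarrow> real" where
  "observed Tr Y i t \<omega> = Y i t (assignment Tr i t \<omega>) \<omega>"

text \<open>
  The filtration is indexed by \<^typ>\<open>enat\<close> only so that the library notion
  \<^const>\<open>stopping_time\<close> applies to stopping times that may be infinite. At index 0 there are no
  generators, so the \<open>\<sigma>\<close>-algebra is trivial.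
\<close>

definition obs_filtration ::
  "'a measure \<Rightarrow> (nat \<Rightarrow> 'i set) \<Rightarrow> (nat \<Rightarrow> 'a \<Rightarrow> 'i set) \<Rightarrow> ('i \<Rightarrow> nat \<Rightarrow> nat \<Rightarrow> 'a \<Rightarrow> real)
    \<Rightarrow> enat \<Rightarrow> 'a measure" where
  "obs_filtration M N Tr Y t = sigma (space M)
     (\<Union>k \<in> {k. 1 \<le> k \<and> enat k \<le> t}. \<Union>i \<in> N k.
        {assignment Tr i k -` S \<inter> space M | S. S \<in> UNIV} \<union>
        {observed Tr Y i k -` S \<inter> space M | S. S \<in> sets borel})"

definition stage_cost ::
  "(nat \<Rightarrow> 'a \<Rightarrow> 'i set) \<Rightarrow> ('i \<Rightarrow> nat \<Rightarrow> nat \<Rightarrow> 'a \<Rightarrow> real) \<Rightarrow> nat \<Rightarrow> 'a \<Rightarrow> real" where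
  "stage_cost Tr Y t \<omega> = (\<Sum>i \<in> Tr t \<omega>. Y i t 1 \<omega> - Y i t 0 \<omega>)"

definition cum_cost ::
  "(nat \<Rightarrow> 'a \<Rightarrow> 'i set) \<Rightarrow> ('i \<Rightarrow> nat \<Rightarrow> nat \<Rightarrow> 'a \<Rightarrow> real) \<Rightarrow> nat \<Rightarrow> 'a \<Rightarrow> real" where
  "cum_cost Tr Y t \<omega> = (\<Sum>k = 1..t. stage_cost Tr Y k \<omega>)"

definition sigma_prob :: "'a measure \<Rightarrow> 'a measure \<Rightarrow> 'a set \<Rightarrow> 'a \<Rightarrow> real" where
  "sigma_prob M F A = real_cond_exp M F (indicat_real A)"

text \<open>
  Conditional probability of \<open>A\<close> given the event \<open>C\<close> and the \<open>\<sigma>\<close>-algebra \<open>F\<close>; meaningful where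
  the conditional probability of \<open>C\<close> given \<open>F\<close> is nonzero.
\<close>

definition sigma_prob_given :: "'a measure \<Rightarrow> 'a measure \<Rightarrow> 'a set \<Rightarrow> 'a set \<Rightarrow> 'a \<Rightarrow> real" where
  "sigma_prob_given M F C A \<omega> = sigma_prob M F (A \<inter> C) \<omega> / sigma_prob M F C \<omega>"

text \<open>
  The two conditions on the treatment groups, at the first stage and at a stage \<open>t \<ge> 2\<close>. The
  parameter \<open>rel\<close> is \<open>(\<le>)\<close> for the conditions themselves and \<open>(=)\<close> when they hold with equality.
  The budget and the tolerance of stage 1 are measurable with respect to the trivial
  \<open>\<sigma>\<close>-algebra, hence constant.
\<close>

definition first_stage_cond ::
  "'a measure \<Rightarrow> (nat \<Rightarrow> 'a \<Rightarrow> 'i set) \<Rightarrow> ('i \<Rightarrow> nat \<Rightarrow> nat \<Rightarrow> 'a \<Rightarrow> real)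
    \<Rightarrow> (nat \<Rightarrow> 'a \<Rightarrow> real) \<Rightarrow> (nat \<Rightarrow> 'a \<Rightarrow> real) \<Rightarrow> (real \<Rightarrow> real \<Rightarrow> bool) \<Rightarrow> 'a \<Rightarrow> bool" where
  "first_stage_cond M Tr Y b \<Delta> rel \<omega> \<longleftrightarrow>
     rel (measure M {x \<in> space M. stage_cost Tr Y 1 x \<le> b 1 x}) (\<Delta> 1 \<omega>)"

definition later_stage_cond ::
  "'a measure \<Rightarrow> (nat \<Rightarrow> 'i set) \<Rightarrow> (nat \<Rightarrow> 'a \<Rightarrow> 'i set) \<Rightarrow> ('i \<Rightarrow> nat \<Rightarrow> nat \<Rightarrow> 'a \<Rightarrow> real)
    \<Rightarrow> real \<Rightarrow> (nat \<Rightarrow> 'a \<Rightarrow> real) \<Rightarrow> (nat \<Rightarrow> 'a \<Rightarrow> real) \<Rightarrow> (real \<Rightarrow> real \<Rightarrow> bool)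
    \<Rightarrow> nat \<Rightarrow> 'a \<Rightarrow> bool" where
  "later_stage_cond M N Tr Y B b \<Delta> rel t \<omega> \<longleftrightarrow>
     (let F = obs_filtration M N Tr Y (enat (t - 1));
          C = {x \<in> space M. cum_cost Tr Y (t - 1) x > B};
          A = {x \<in> space M. cum_cost Tr Y t x \<le> b t x}
      in if sigma_prob M F C \<omega> = 0 then Tr t \<omega> = {}
         else rel (sigma_prob_given M F C A \<omega>) (\<Delta> t \<omega>))"

text \<open>
  The product of the \<open>1 - \<Delta>\<^sub>t\<close> over \<open>1 \<le> t \<le> T\<close>. For infinite \<open>T\<close> it is the limit of the partial
  products rather than \<^const>\<open>prodinf\<close>, which is unspecified when that limit is 0 without any
  factor being 0.
\<close>

definition survival_prod :: "(nat \<Rightarrow> 'a \<Rightarrow> real) \<Rightarrow> ('a \<Rightarrow> enat) \<Rightarrow> 'a \<Rightarrow> real" where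
  "survival_prod \<Delta> T \<omega> =
     (case T \<omega> of enat n \<Rightarrow> (\<Prod>t = 1..n. 1 - \<Delta> t \<omega>)
                | \<infinity> \<Rightarrow> lim (\<lambda>n. \<Prod>t = 1..n. 1 - \<Delta> t \<omega>))"

text \<open>
  The event \<open>R\<^sub>T > B\<close>. On \<open>T = \<infinity>\<close> it is the limit of the events \<open>R\<^sub>n > B\<close>, that is,
  \<open>R\<^sub>n > B\<close> for all sufficiently large \<open>n\<close>. A strict inequality for \<open>lim R\<^sub>n\<close> would be too strong
  (\<open>R\<^sub>n\<close> may decrease to \<open>B\<close> without ever reaching it), and so would \<open>R\<^sub>n > B\<close> for every \<open>n\<close>,
  which already fails for finite \<open>T\<close>: the cumulative cost may fall below \<open>B\<close> and recover.
\<close>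

definition final_above ::
  "(nat \<Rightarrow> 'a \<Rightarrow> 'i set) \<Rightarrow> ('i \<Rightarrow> nat \<Rightarrow> nat \<Rightarrow> 'a \<Rightarrow> real) \<Rightarrow> ('a \<Rightarrow> enat) \<Rightarrow> real \<Rightarrow> 'a \<Rightarrow> bool" where
  "final_above Tr Y T B \<omega> \<longleftrightarrow>
     (case T \<omega> of enat n \<Rightarrow> cum_cost Tr Y n \<omega> > B
                | \<infinity> \<Rightarrow> (\<forall>\<^sub>F n in sequentially. cum_cost Tr Y n \<omega> > B))"

end

theory Submission
  imports Defs
begin

text \<open>
  Write \<open>C n\<close> for the event that the cost stopped at \<open>T\<close> exceeds \<open>B\<close> after stage \<open>n\<close>, \<open>L n\<close> for the
  event that stage \<open>n + 1\<close> takes place and breaks its budget although \<open>R\<^sub>n > B\<close>, and \<open>D n\<close> for the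
  tolerance of stage \<open>n + 1\<close> (0 after \<open>T\<close>). The conditions on the treatment groups say
  \<open>\<bbbP>(L n | F n) \<le> D n * \<bbbP>(C n | F n)\<close>, and \<open>C n - L n \<subseteq> C (n + 1)\<close>, so the expectation of
  \<open>1\<^sub>C\<^sub>n / (\<Prod>k<n. 1 - D k)\<close> never decreases from its initial value 1. As the product is at least
  \<open>1 - \<delta>\<close>, this gives \<open>\<bbbP>(C n) \<ge> 1 - \<delta>\<close> for every \<open>n\<close>. The same bound makes the sum of the
  \<open>\<bbbP>(L n)\<close> finite, hence by Borel-Cantelli the events \<open>C n\<close> stabilise almost surely and the bound
  passes to the limit, including on \<open>T = \<infinity>\<close>. If all conditions are equalities and costs are
  nonpositive, the expectation is constant.
\<close>

section \<open>Processes with a conditional bound on the losses\<close>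

text \<open>The field \<open>loss\<close> is \<open>\<bbbP>(L n | F n) \<le> D n * \<bbbP>(C n | F n)\<close>, tested against bounded functions.\<close>

locale survival_process = prob_space M for M :: "'a measure" +
  fixes F :: "nat \<Rightarrow> 'a measure"
    and C L :: "nat \<Rightarrow> 'a set"
    and D :: "nat \<Rightarrow> 'a \<Rightarrow> real"
    and c :: real
  assumes subalg: "\<And>n. subalgebra M (F n)"
    and C_meas: "\<And>n. C n \<in> sets M"
    and L_meas: "\<And>n. L n \<in> sets M"
    and D_adapted: "\<And>m n. m \<le> n \<Longrightarrow> D m \<in> borel_measurable (F n)"
    and c_pos: "0 < c"
    and C_0: "C 0 = space M"
    and D_range: "AE x in M. \<forall>n. 0 \<le> D n x \<and> D n x < 1"
    and prod_bound: "AE x in M. \<forall>n. c \<le> (\<Prod>k<n. 1 - D k x)"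
    and survive: "AE x in M. \<forall>n. x \<in> C n \<longrightarrow> x \<notin> L n \<longrightarrow> x \<in> C (Suc n)"
    and loss: "\<And>n f K. f \<in> borel_measurable (F n) \<Longrightarrow> (\<And>x. 0 \<le> f x) \<Longrightarrow> (\<And>x. f x \<le> K) \<Longrightarrow>
      (\<integral>x. f x * indicator (L n) x \<partial>M) \<le> (\<integral>x. f x * D n x * indicator (C n) x \<partial>M)"
begin

definition P :: "nat \<Rightarrow> 'a \<Rightarrow> real" where
  "P n x = (\<Prod>k<n. 1 - D k x)"

text \<open>\<open>P\<close> is bounded below by \<open>c\<close> only almost everywhere; the truncation makes \<open>1 / Q\<close> bounded
  everywhere.\<close>

definition Q :: "nat \<Rightarrow> 'a \<Rightarrow> real" where
  "Q n x = max c (P n x)"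

lemma Q_ge: "c \<le> Q n x" and Q_pos: "0 < Q n x"
  using c_pos by (auto simp: Q_def)

lemma inverse_Q_le: "1 / Q n x \<le> 1 / c"
  using Q_ge c_pos by (simp add: frac_le)

lemma D_meas [measurable]: "D n \<in> borel_measurable M"
  using D_adapted[of n n] subalg measurable_from_subalg by blast

lemma P_meas [measurable]: "P n \<in> borel_measurable M"
  unfolding P_def by measurable

lemma Q_meas [measurable]: "Q n \<in> borel_measurable M"
  unfolding Q_def by measurable

declare C_meas [measurable] L_meas [measurable]

text \<open>The tolerance of stage \<open>n + 1\<close> is fixed before that stage, so the weight
  \<open>1 / Q (Suc n)\<close> is already known at time \<open>n\<close> and may serve as a test
  function in \<open>loss\<close>.\<close>

lemma Q_Suc_adapted: "Q (Suc n) \<in> borel_measurable (F n)"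
proof -
  have "(\<lambda>x. 1 - D k x) \<in> borel_measurable (F n)" if "k < Suc n" for k
    using D_adapted[of k n] that by simp
  then have "P (Suc n) \<in> borel_measurable (F n)"
    unfolding P_def by (intro borel_measurable_prod) auto
  then show ?thesis
    unfolding Q_def by measurable
qed

lemma AE_good: "AE x in M. \<forall>n. 0 \<le> D n x \<and> D n x < 1 \<and> c \<le> P n x \<and> P n x \<le> 1 \<and> Q n x = P n x"
  using D_range prod_bound
proof eventually_elim
  case (elim x)
  then have "P n x \<le> 1" for n
    unfolding P_def by (intro prod_le_1) (auto simp: less_imp_le)
  with elim show ?case
    by (auto simp: Q_def P_def)
qed

lemma norm_quot_le: "norm (indicator A x / Q n x) \<le> 1 / c"
  using inverse_Q_le[of n x] Q_pos[of n x] c_pos by (auto simp: indicator_def less_imp_le)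

lemma integrable_quot:
  assumes [measurable]: "A \<in> sets M"
  shows "integrable M (\<lambda>x. indicator A x / Q n x)"
  by (rule integrable_const_bound[of _ "1 / c"]) (rule AE_I2, rule norm_quot_le, simp)

lemma integrable_quot_D: "integrable M (\<lambda>x. 1 / Q m x * D n x * indicator (C n) x)"
proof (rule integrable_const_bound[of _ "1 / c"])
  show "AE x in M. norm (1 / Q m x * D n x * indicator (C n) x) \<le> 1 / c"
    using AE_good
  proof eventually_elim
    case (elim x)
    have "1 / Q m x * D n x \<le> 1 / c * 1"
      using inverse_Q_le[of m x] elim Q_pos[of m x] c_pos
      by (intro mult_mono) (auto simp: less_imp_le)
    moreover have "0 \<le> 1 / Q m x * D n x"
      using elim Q_pos[of m x] by (intro mult_nonneg_nonneg) (auto simp: less_imp_le)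
    ultimately show ?case
      using c_pos by (auto simp: indicator_def abs_mult)
  qed
qed simp

text \<open>Almost everywhere \<open>Q (Suc n) = Q n * (1 - D n)\<close>: the growth of the weight
  exactly offsets a loss of the share \<open>D n\<close>. The cancellation uses
  \<open>D n < 1\<close>.\<close>

lemma integral_quot_Suc:
  "(\<integral>x. indicator (C n) x / Q (Suc n) x \<partial>M) - (\<integral>x. 1 / Q (Suc n) x * D n x * indicator (C n) x \<partial>M)
    = (\<integral>x. indicator (C n) x / Q n x \<partial>M)"
proof -
  have "(\<integral>x. indicator (C n) x / Q (Suc n) x - 1 / Q (Suc n) x * D n x * indicator (C n) x \<partial>M)
    = (\<integral>x. indicator (C n) x / Q n x \<partial>M)"
  proof (rule integral_cong_AE)
    show "AE x in M. indicator (C n) x / Q (Suc n) x - 1 / Q (Suc n) x * D n x * indicator (C n) x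
        = indicator (C n) x / Q n x"
      using AE_good
    proof eventually_elim
      case (elim x)
      then have "Q (Suc n) x = Q n x * (1 - D n x)"
        by (simp add: P_def)
      moreover have "1 - D n x \<noteq> 0"
        using elim by (metis diff_gt_0_iff_gt less_irrefl)
      moreover have "Q n x \<noteq> 0"
        using Q_pos[of n x] by simp
      ultimately show ?case
        by (auto simp: indicator_def divide_simps)
    qed
  qed simp_all
  then show ?thesis
    using integrable_quot[of "C n" "Suc n"] integrable_quot_D[of "Suc n" n] by simp
qed

text \<open>This is \<open>loss\<close> tested with \<open>1 / Q (Suc n)\<close>, which the
  truncation keeps below \<open>1 / c\<close>.\<close>

lemma loss_quot:
  "(\<integral>x. indicator (L n) x / Q (Suc n) x \<partial>M) \<le> (\<integral>x. 1 / Q (Suc n) x * D n x * indicator (C n) x \<partial>M)"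
proof -
  have "(\<lambda>x. 1 / Q (Suc n) x) \<in> borel_measurable (F n)"
    using Q_Suc_adapted[of n] by measurable
  from loss[OF this, of "1 / c"] show ?thesis
    using inverse_Q_le Q_pos by (simp add: less_imp_le)
qed

text \<open>A point of \<open>C n\<close> outside \<open>L n\<close> stays in
  \<open>C (Suc n)\<close>, and the weighted mass removed by \<open>L n\<close> is at most the mass
  gained on \<open>C n\<close> by passing from the old weight to the new one.\<close>

lemma integral_quot_mono:
  "(\<integral>x. indicator (C n) x / Q n x \<partial>M) \<le> (\<integral>x. indicator (C (Suc n)) x / Q (Suc n) x \<partial>M)"
proof -
  have "(\<integral>x. indicator (C n) x / Q (Suc n) x - indicator (L n) x / Q (Suc n) x \<partial>M)
     \<le> (\<integral>x. indicator (C (Suc n)) x / Q (Suc n) x \<partial>M)"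
  proof (rule integral_mono_AE)
    show "AE x in M. indicator (C n) x / Q (Suc n) x - indicator (L n) x / Q (Suc n) x
        \<le> indicator (C (Suc n)) x / Q (Suc n) x"
      using survive
    proof eventually_elim
      case (elim x)
      then show ?case
        using Q_pos[of "Suc n" x] by (auto simp: indicator_def field_simps)
    qed
  qed (simp_all add: integrable_quot)
  then show ?thesis
    using integral_quot_Suc[of n] loss_quot[of n] by (simp add: integrable_quot)
qed

lemma integral_quot_0: "c \<le> 1" "(\<integral>x. indicator (C 0) x / Q 0 x \<partial>M) = 1"
proof -
  \<comment> \<open>The empty product, at \<open>n = 0\<close>, gives the bound; it does not depend
    on \<open>x\<close>, so it holds outright. Hence the truncation does not change
    \<open>Q 0 = 1\<close>.\<close>
  have "AE x in M. c \<le> 1"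
    using prod_bound by eventually_elim (auto dest: spec[of _ 0])
  then show "c \<le> 1"
    by simp
  then have "(\<integral>x. indicator (C 0) x / Q 0 x \<partial>M) = (\<integral>x. 1 \<partial>M)"
    by (intro Bochner_Integration.integral_cong) (auto simp: C_0 Q_def P_def max_def)
  then show "(\<integral>x. indicator (C 0) x / Q 0 x \<partial>M) = 1"
    by (simp add: prob_space)
qed

lemma integral_quot_ge_1: "1 \<le> (\<integral>x. indicator (C n) x / Q n x \<partial>M)"
proof (induction n)
  case 0
  then show ?case using integral_quot_0 by simp
next
  case (Suc n)
  then show ?case using integral_quot_mono[of n] by simp
qed

text \<open>The weight is at most \<open>1 / c\<close>, so a weighted mass of at least 1 forces
  \<open>prob (C n) / c \<ge> 1\<close>.\<close>

lemma prob_C_ge: "c \<le> prob (C n)"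
proof -
  have "(\<integral>x. indicator (C n) x / Q n x \<partial>M) \<le> (\<integral>x. indicator (C n) x * (1 / c) \<partial>M)"
  proof (rule integral_mono)
    show "indicator (C n) x / Q n x \<le> indicator (C n) x * (1 / c)" for x
      using inverse_Q_le[of n x] by (simp add: indicator_def)
    show "integrable M (\<lambda>x. indicator (C n) x * (1 / c))"
      by (intro integrable_mult_left integrable_real_indicator) (auto simp: less_top[symmetric])
  qed (simp add: integrable_quot)
  also have "\<dots> = prob (C n) / c"
    by simp
  finally have "1 \<le> prob (C n) / c"
    using integral_quot_ge_1[of n] by simp
  then show ?thesis
    using c_pos by (simp add: pos_le_divide_eq)
qed

section \<open>Summability of the losses and passage to the limit\<close>

text \<open>Tested with the constant \<open>c\<close>, \<open>loss\<close> bounds the left side by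
  the integral of \<open>c * D n\<close> over \<open>C n\<close>. As \<open>c \<le> P n\<close>,
  this is at most the integral of \<open>P n * D n = P n - P (Suc n)\<close>, which
  telescopes.\<close>

lemma prob_L_le: "c * prob (L n) \<le> (\<integral>x. P n x \<partial>M) - (\<integral>x. P (Suc n) x \<partial>M)"
proof -
  have P_int: "integrable M (P n)" for n
  proof (rule integrable_const_bound[of _ 1])
    show "AE x in M. norm (P n x) \<le> 1"
      using AE_good
    proof eventually_elim
      case (elim x)
      then have "c \<le> P n x" "P n x \<le> 1"
        by auto
      then show ?case
        using c_pos by simp
    qed
  qed simp
  have D_int: "integrable M (\<lambda>x. D n x * indicator (C n) x)"
  proof (rule integrable_const_bound[of _ 1])
    show "AE x in M. norm (D n x * indicator (C n) x) \<le> 1"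
      using D_range by eventually_elim (auto simp: indicator_def less_imp_le)
  qed simp
  have "c * prob (L n) = (\<integral>x. c * indicator (L n) x \<partial>M)"
    by simp
  also have "\<dots> \<le> (\<integral>x. c * D n x * indicator (C n) x \<partial>M)"
    using c_pos by (intro loss[of _ _ c]) auto
  also have "\<dots> \<le> (\<integral>x. P n x - P (Suc n) x \<partial>M)"
  proof (rule integral_mono_AE)
    show "AE x in M. c * D n x * indicator (C n) x \<le> P n x - P (Suc n) x"
      using AE_good
    proof eventually_elim
      case (elim x)
      then have "0 \<le> D n x" "c \<le> P n x"
        by auto
      then have "c * D n x \<le> P n x * D n x" "0 \<le> P n x * D n x"
        using c_pos by (simp_all add: mult_right_mono)
      then show ?case
        by (auto simp: P_def indicator_def algebra_simps)
    qed
  qed (use D_int P_int in \<open>simp_all add: mult.assoc\<close>)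
  finally show ?thesis
    using P_int by simp
qed

text \<open>The bounds of \<open>prob_L_le\<close> telescope, and the integral of \<open>P\<close>
  starts at 1 and stays nonnegative, so the partial sums are at most \<open>1 / c\<close>.\<close>

lemma summable_prob_L: "summable (\<lambda>n. prob (L n))"
proof (rule bounded_imp_summable)
  fix n
  have "c * (\<Sum>k\<le>n. prob (L k)) \<le> (\<Sum>k\<le>n. (\<integral>x. P k x \<partial>M) - (\<integral>x. P (Suc k) x \<partial>M))"
    unfolding sum_distrib_left by (intro sum_mono prob_L_le)
  also have "\<dots> = (\<integral>x. P 0 x \<partial>M) - (\<integral>x. P (Suc n) x \<partial>M)"
    using sum_telescope[of "\<lambda>n. \<integral>x. P n x \<partial>M" n] by simp
  also have "(\<integral>x. P 0 x \<partial>M) = 1"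
    by (simp add: P_def prob_space)
  finally have "c * (\<Sum>k\<le>n. prob (L k)) \<le> 1 - (\<integral>x. P (Suc n) x \<partial>M)" .
  moreover have "0 \<le> (\<integral>x. P (Suc n) x \<partial>M)"
  proof (rule integral_nonneg_AE)
    show "AE x in M. 0 \<le> P (Suc n) x"
      using AE_good by eventually_elim (meson c_pos less_le_trans less_imp_le)
  qed
  ultimately show "(\<Sum>k\<le>n. prob (L k)) \<le> 1 / c"
    using c_pos by (simp add: field_simps)
qed simp

text \<open>The lower limit of the events \<open>C n\<close>. Membership may be lost and regained,
  so the intersection of all \<open>C n\<close> could be too small.\<close>

definition survivors :: "'a set" where
  "survivors = {x \<in> space M. \<forall>\<^sub>F n in sequentially. x \<in> C n}"

lemma survivors_meas [measurable]: "survivors \<in> sets M"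
  unfolding survivors_def eventually_sequentially by measurable

text \<open>By Borel-Cantelli only finitely many losses occur, after which the events \<open>C n\<close> can only
  switch on.\<close>

lemma indicator_C_tendsto: "AE x in M. (\<lambda>n. indicator (C n) x :: real) \<longlonglongrightarrow> indicator survivors x"
proof -
  have "AE x in M. \<forall>\<^sub>F n in sequentially. x \<in> space M - L n"
    by (rule borel_cantelli_AE1) (auto simp: summable_prob_L L_meas less_top[symmetric])
  then show ?thesis
    using survive AE_space
  proof eventually_elim
    case (elim x)
    then obtain n0 where n0: "\<And>n. n \<ge> n0 \<Longrightarrow> x \<notin> L n"
      by (auto simp: eventually_sequentially)
    show ?case
    proof (cases "\<exists>m\<ge>n0. x \<in> C m")
      case True
      then obtain m where m: "m \<ge> n0" "x \<in> C m"
        by auto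
      have "x \<in> C n" if "n \<ge> m" for n
        using that by (induction rule: dec_induct) (use m n0 elim in auto)
      then have ev: "\<forall>\<^sub>F n in sequentially. x \<in> C n"
        by (auto simp: eventually_sequentially)
      then have "x \<in> survivors"
        using elim by (simp add: survivors_def)
      with ev show ?thesis
        by (intro tendsto_eventually) (auto elim: eventually_mono)
    next
      case False
      then have ev: "\<forall>\<^sub>F n in sequentially. x \<notin> C n"
        by (auto simp: eventually_sequentially)
      moreover have "x \<notin> survivors"
        using False by (auto simp: survivors_def eventually_sequentially) (meson nle_le)
      ultimately show ?thesis
        by (intro tendsto_eventually) (auto elim: eventually_mono)
    qed
  qed
qed

text \<open>The bound \<open>prob_C_ge\<close> is uniform in \<open>n\<close>, and dominated
  convergence carries it to the limit event.\<close>

theorem prob_survivors_ge: "c \<le> prob survivors"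
proof -
  have "(\<lambda>n. \<integral>x. indicator (C n) x \<partial>M) \<longlonglongrightarrow> (\<integral>x. (indicator survivors x :: real) \<partial>M)"
    using indicator_C_tendsto
    by (intro integral_dominated_convergence[where w = "\<lambda>_. 1"]) (auto simp: indicator_def)
  then have "(\<lambda>n. prob (C n)) \<longlonglongrightarrow> prob survivors"
    by simp
  then show ?thesis
    by (rule LIMSEQ_le_const) (use prob_C_ge in auto)
qed

end

section \<open>The case of equality\<close>

text \<open>By \<open>survive_iff\<close> a point that leaves \<open>C n\<close> almost surely never
  returns, and by \<open>loss_eq\<close> the loss is exactly the permitted one, so the weighted mass
  is conserved. \<open>prod_tendsto\<close> fixes the limiting weight at
  \<open>1 / c\<close>.\<close>

locale exact_survival_process = survival_process +
  assumes survive_iff: "AE x in M. \<forall>n. x \<in> C (Suc n) \<longleftrightarrow> x \<in> C n \<and> x \<notin> L n"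
    and L_subset: "\<And>n. L n \<subseteq> C n"
    and loss_eq: "\<And>n f K. f \<in> borel_measurable (F n) \<Longrightarrow> (\<And>x. 0 \<le> f x) \<Longrightarrow> (\<And>x. f x \<le> K) \<Longrightarrow>
      (\<integral>x. f x * indicator (L n) x \<partial>M) = (\<integral>x. f x * D n x * indicator (C n) x \<partial>M)"
    and prod_tendsto: "AE x in M. (\<lambda>n. \<Prod>k<n. 1 - D k x) \<longlonglongrightarrow> c"
begin

lemma integral_quot_eq_1: "(\<integral>x. indicator (C n) x / Q n x \<partial>M) = 1"
proof (induction n)
  case 0
  then show ?case by (rule integral_quot_0)
next
  case (Suc n)
  have "(\<lambda>x. 1 / Q (Suc n) x) \<in> borel_measurable (F n)"
    using Q_Suc_adapted[of n] by measurable
  from loss_eq[OF this, of "1 / c"]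
  have loss_Q: "(\<integral>x. indicator (L n) x / Q (Suc n) x \<partial>M)
      = (\<integral>x. 1 / Q (Suc n) x * D n x * indicator (C n) x \<partial>M)"
    using inverse_Q_le Q_pos by (simp add: less_imp_le)
  have "(\<integral>x. indicator (C (Suc n)) x / Q (Suc n) x \<partial>M)
      = (\<integral>x. indicator (C n) x / Q (Suc n) x - indicator (L n) x / Q (Suc n) x \<partial>M)"
  proof (rule integral_cong_AE)
    show "AE x in M. indicator (C (Suc n)) x / Q (Suc n) x
        = indicator (C n) x / Q (Suc n) x - indicator (L n) x / Q (Suc n) x"
      using survive_iff
    proof eventually_elim
      case (elim x)
      then show ?case
        using L_subset[of n] by (auto simp: indicator_def)
    qed
  qed simp_all
  then show ?case
    using integral_quot_Suc[of n] loss_Q Suc by (simp add: integrable_quot)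
qed

text \<open>Almost surely the weights tend to \<open>1 / c\<close> and the indicators stabilise, so
  the integrals, all equal to 1, converge to \<open>prob survivors / c\<close>.\<close>

theorem prob_survivors_eq: "prob survivors = c"
proof -
  have "(\<lambda>n. \<integral>x. indicator (C n) x / Q n x \<partial>M) \<longlonglongrightarrow> (\<integral>x. indicator survivors x / c \<partial>M)"
  proof (rule integral_dominated_convergence[where w = "\<lambda>_. 1 / c"])
    show "AE x in M. (\<lambda>n. indicator (C n) x / Q n x) \<longlonglongrightarrow> indicator survivors x / c"
      using indicator_C_tendsto prod_tendsto AE_good
    proof eventually_elim
      case (elim x)
      then have "(\<lambda>n. Q n x) \<longlonglongrightarrow> c"
        by (simp add: P_def)
      then show ?case
        using elim c_pos by (intro tendsto_divide) auto
    qed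
    show "AE x in M. norm (indicator (C n) x / Q n x) \<le> 1 / c" for n
      by (rule AE_I2) (rule norm_quot_le)
  qed simp_all
  then have "1 = prob survivors / c"
    by (simp add: integral_quot_eq_1 LIMSEQ_const_iff)
  then show ?thesis
    using c_pos by simp
qed

end

section \<open>Measurability in the experiment\<close>

context phased_experiment
begin

abbreviation F :: "nat \<Rightarrow> 'a measure" where
  "F n \<equiv> obs_filtration M N Tr Y (enat n)"

lemma measurable_in_Tr: "t \<ge> 1 \<Longrightarrow> i \<in> N t \<Longrightarrow> Measurable.pred M (\<lambda>x. i \<in> Tr t x)"
  using treated_measurable by (simp add: pred_def)

lemma assignment_measurable:
  assumes "t \<ge> 1" "i \<in> N t"
  shows "assignment Tr i t \<in> measurable M (count_space UNIV)"
proof -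
  note [measurable] = measurable_in_Tr[OF assms]
  show ?thesis
    unfolding assignment_def[abs_def] by measurable
qed

lemma observed_measurable:
  assumes "t \<ge> 1" "i \<in> N t"
  shows "observed Tr Y i t \<in> borel_measurable M"
proof -
  note [measurable] = measurable_in_Tr[OF assms] outcome_measurable[OF assms]
  have "observed Tr Y i t = (\<lambda>x. if i \<in> Tr t x then Y i t 1 x else Y i t 0 x)"
    by (auto simp: observed_def assignment_def)
  then show ?thesis
    by simp
qed

lemma space_F: "space (obs_filtration M N Tr Y t) = space M"
  by (simp add: obs_filtration_def space_measure_of_conv)

lemma subalgebra_F: "subalgebra M (obs_filtration M N Tr Y t)"
  unfolding subalgebra_def
proof
  let ?G = "\<Union>k \<in> {k. 1 \<le> k \<and> enat k \<le> t}. \<Union>i \<in> N k.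
        {assignment Tr i k -` S \<inter> space M | S. S \<in> UNIV} \<union>
        {observed Tr Y i k -` S \<inter> space M | S. S \<in> sets borel}"
  have G: "?G \<subseteq> sets M"
    using measurable_sets[OF assignment_measurable] measurable_sets[OF observed_measurable] by auto
  then have "?G \<subseteq> Pow (space M)"
    using sets.space_closed by blast
  then show "sets (obs_filtration M N Tr Y t) \<subseteq> sets M"
    unfolding obs_filtration_def using sets.sigma_sets_subset[OF G] by simp
qed (rule space_F)

lemma sets_F_mono:
  assumes "s \<le> t"
  shows "sets (obs_filtration M N Tr Y s) \<subseteq> sets (obs_filtration M N Tr Y t)"
proof -
  have "{k. 1 \<le> k \<and> enat k \<le> s} \<subseteq> {k. 1 \<le> k \<and> enat k \<le> t}"
    using assms by (blast intro: order_trans)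
  then show ?thesis
    unfolding obs_filtration_def
    by (subst (1 2) sets_measure_of) (blast intro!: sigma_sets_mono')+
qed

lemma measurable_F_mono:
  "f \<in> borel_measurable (F m) \<Longrightarrow> m \<le> n \<Longrightarrow> f \<in> borel_measurable (F n)"
  using sets_F_mono[of "enat m" "enat n"] by (auto simp: measurable_def space_F)

lemma measurable_F_imp: "f \<in> borel_measurable (F n) \<Longrightarrow> f \<in> borel_measurable M"
  using measurable_from_subalg[OF subalgebra_F] .

text \<open>The preimage of \<open>{f y}\<close> belongs to the trivial \<sigma>-algebra and
  contains \<open>y\<close>, so it is the whole space.\<close>

lemma F_0_const:
  assumes f: "f \<in> borel_measurable (F 0)" and "x \<in> space M" "y \<in> space M"
  shows "f x = (f y :: real)"
proof -
  have "{k::nat. 1 \<le> k \<and> enat k \<le> enat 0} = {}"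
    by auto
  then have "sets (F 0) = {{}, space M}"
    unfolding obs_filtration_def by (simp only:) (simp add: sigma_sets_empty_eq)
  moreover have "f -` {f y} \<inter> space M \<in> sets (F 0)"
    using measurable_sets[OF f, of "{f y}"] by (simp add: space_F)
  ultimately show ?thesis
    using assms by auto
qed

text \<open>The index set of the sum is random; the cost is rewritten as a sum over the fixed finite
  set \<open>N t\<close> with a case distinction in each term.\<close>

lemma stage_cost_measurable:
  assumes t: "t \<ge> 1"
  shows "stage_cost Tr Y t \<in> borel_measurable M"
proof -
  have "(\<lambda>x. if i \<in> Tr t x then Y i t 1 x - Y i t 0 x else 0) \<in> borel_measurable M"
    if "i \<in> N t" for i
  proof -
    note [measurable] = measurable_in_Tr[OF t that] outcome_measurable[OF t that]
    show ?thesis by simp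
  qed
  then have "(\<lambda>x. \<Sum>i\<in>N t. if i \<in> Tr t x then Y i t 1 x - Y i t 0 x else 0) \<in> borel_measurable M"
    by (rule borel_measurable_sum)
  moreover have "stage_cost Tr Y t x = (\<Sum>i\<in>N t. if i \<in> Tr t x then Y i t 1 x - Y i t 0 x else 0)"
    if "x \<in> space M" for x
    using treated_subset[OF t that] finite_units[OF t]
    by (simp add: stage_cost_def sum.If_cases Int_absorb1)
  ultimately show ?thesis
    by (simp cong: measurable_cong)
qed

lemma cum_cost_measurable [measurable]: "cum_cost Tr Y t \<in> borel_measurable M"
  unfolding cum_cost_def[abs_def] by (intro borel_measurable_sum stage_cost_measurable) auto

lemma cum_cost_Suc: "cum_cost Tr Y (Suc n) x = cum_cost Tr Y n x + stage_cost Tr Y (Suc n) x"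
  by (simp add: cum_cost_def)

section \<open>Conditional probabilities given the observations\<close>

text \<open>The averaging property of conditional expectation for a bounded test function known at
  time \<open>n\<close>. The bound is asked only almost everywhere because the tolerances lie in
  \<open>[0, 1)\<close> only almost everywhere.\<close>

lemma integral_sigma_prob:
  assumes f: "f \<in> borel_measurable (F n)" and bound: "AE x in M. norm (f x) \<le> K"
    and [measurable]: "A \<in> sets M"
  shows "integrable M (\<lambda>x. f x * sigma_prob M (F n) A x)"
    and "(\<integral>x. f x * sigma_prob M (F n) A x \<partial>M) = (\<integral>x. f x * indicator A x \<partial>M)"
proof -
  interpret S: finite_measure_subalgebra M "F n"
    by unfold_locales (rule subalgebra_F)
  note [measurable] = measurable_F_imp[OF f]
  have int: "integrable M (\<lambda>x. f x * indicat_real A x)"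
  proof (rule integrable_const_bound[of _ K])
    show "AE x in M. norm (f x * indicat_real A x) \<le> K"
      using bound by eventually_elim (auto simp: indicator_def)
  qed simp
  show "integrable M (\<lambda>x. f x * sigma_prob M (F n) A x)"
    and "(\<integral>x. f x * sigma_prob M (F n) A x \<partial>M) = (\<integral>x. f x * indicator A x \<partial>M)"
    unfolding sigma_prob_def using S.real_cond_exp_intg[OF int f] by simp_all
qed

text \<open>Conditional expectation preserves the order of the indicators. Thus the numerator of
  \<open>sigma_prob_given\<close> vanishes almost surely wherever its denominator does.\<close>

lemma sigma_prob_mono:
  assumes [measurable]: "A \<in> sets M" "A' \<in> sets M" and "A \<subseteq> A'"
  shows "AE x in M. 0 \<le> sigma_prob M (F n) A x \<and> sigma_prob M (F n) A x \<le> sigma_prob M (F n) A' x"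
proof -
  interpret S: finite_measure_subalgebra M "F n"
    by unfold_locales (rule subalgebra_F)
  have "AE x in M. 0 \<le> sigma_prob M (F n) A x"
    unfolding sigma_prob_def by (rule S.real_cond_exp_pos) auto
  moreover have "AE x in M. sigma_prob M (F n) A x \<le> sigma_prob M (F n) A' x"
    unfolding sigma_prob_def using assms
    by (intro S.real_cond_exp_mono) (auto simp: indicator_def less_top[symmetric])
  ultimately show ?thesis
    by eventually_elim auto
qed

text \<open>The indicator of \<open>G\<close> is known at time \<open>n\<close> and can be pulled
  out of the conditional expectation of a function that is 0 almost everywhere.\<close>

lemma sigma_prob_eq_0:
  assumes G: "G \<in> sets (F n)" and [measurable]: "A \<in> sets M"
    and null: "AE x in M. x \<in> G \<longrightarrow> x \<notin> A"
  shows "AE x in M. x \<in> G \<longrightarrow> sigma_prob M (F n) A x = 0"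
proof -
  interpret S: finite_measure_subalgebra M "F n"
    by unfold_locales (rule subalgebra_F)
  have [measurable]: "G \<in> sets M"
    using G subalgebra_F by (auto simp: subalgebra_def)
  have int: "integrable M (\<lambda>x. indicat_real G x * indicat_real A x)"
    by (rule integrable_const_bound[of _ 1]) (auto simp: indicator_def)
  have "AE x in M. real_cond_exp M (F n) (\<lambda>x. indicat_real G x * indicat_real A x) x
      = indicat_real G x * real_cond_exp M (F n) (indicat_real A) x"
    using G int by (intro S.real_cond_exp_mult) auto
  moreover have "AE x in M. real_cond_exp M (F n) (\<lambda>x. indicat_real G x * indicat_real A x) x
      = real_cond_exp M (F n) (\<lambda>_. 0) x"
  proof (rule S.real_cond_exp_cong)
    show "AE x in M. indicat_real G x * indicat_real A x = 0"
      using null by eventually_elim (auto simp: indicator_def)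
  qed simp_all
  moreover have "AE x in M. real_cond_exp M (F n) (\<lambda>_. 0) x = 0"
    by (rule S.real_cond_exp_F_meas) auto
  ultimately show ?thesis
    unfolding sigma_prob_def by eventually_elim auto
qed

end

section \<open>The experiment stopped at \<open>T\<close>\<close>

text \<open>These hypotheses are common to all claims; the conditions on the product and on the
  treatment groups differ between the claims and are left to the lemmas.\<close>

locale risk_experiment = phased_experiment M N Tr Y
  for M :: "'a measure" and N :: "nat \<Rightarrow> 'i set" and Tr Y +
  fixes B :: real and T :: "'a \<Rightarrow> enat" and b \<Delta> :: "nat \<Rightarrow> 'a \<Rightarrow> real"
  assumes B_neg: "B < 0"
    and stopping: "stopping_time (obs_filtration M N Tr Y) T"
    and T_ge_1: "\<And>x. x \<in> space M \<Longrightarrow> T x \<ge> 1"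
    and b_adapted: "\<And>t. t \<ge> 1 \<Longrightarrow> b t \<in> borel_measurable (obs_filtration M N Tr Y (enat (t - 1)))"
    and \<Delta>_adapted: "\<And>t. t \<ge> 1 \<Longrightarrow> \<Delta> t \<in> borel_measurable (obs_filtration M N Tr Y (enat (t - 1)))"
    and b_ge: "AE x in M. \<forall>t\<ge>1. enat t \<le> T x \<longrightarrow> b t x \<ge> B"
    and \<Delta>_range: "AE x in M. \<forall>t\<ge>1. enat t \<le> T x \<longrightarrow> 0 \<le> \<Delta> t x \<and> \<Delta> t x < 1"
begin

definition active :: "nat \<Rightarrow> 'a set" where
  "active n = {x \<in> space M. enat n < T x}"

text \<open>The cost frozen at \<open>T\<close>, which treats finite and infinite \<open>T\<close>
  alike. Index \<open>k\<close> stands for stage \<open>k + 1\<close>, which takes place iff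
  \<open>k < T\<close>.\<close>

definition stopped_cost :: "nat \<Rightarrow> 'a \<Rightarrow> real" where
  "stopped_cost n x = (\<Sum>k<n. if enat k < T x then stage_cost Tr Y (Suc k) x else 0)"

definition above :: "nat \<Rightarrow> 'a set" where
  "above n = {x \<in> space M. B < stopped_cost n x}"

definition lost :: "nat \<Rightarrow> 'a set" where
  "lost n = {x \<in> space M. enat n < T x \<and> B < cum_cost Tr Y n x \<and> cum_cost Tr Y (Suc n) x \<le> b (Suc n) x}"

text \<open>The value 0 from \<open>T\<close> on freezes the product of the survival
  factors.\<close>

definition risk :: "nat \<Rightarrow> 'a \<Rightarrow> real" where
  "risk n x = (if enat n < T x then \<Delta> (Suc n) x else 0)"

text \<open>As \<open>T\<close> is a stopping time, it is known at time \<open>n\<close> whether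
  stage \<open>n + 1\<close> takes place.\<close>

lemma active_F: "Measurable.pred (F n) (\<lambda>x. enat n < T x)"
  using stopping_timeD2[OF stopping] .

lemma active_M [measurable]: "Measurable.pred M (\<lambda>x. enat n < T x)"
  using active_F[of n] subalgebra_F by (rule measurable_from_subalg[rotated])

lemma b_measurable [measurable]: "b (Suc n) \<in> borel_measurable M"
  using b_adapted[of "Suc n"] by (auto intro: measurable_F_imp)

lemma risk_F: "risk n \<in> borel_measurable (F n)"
proof -
  note [measurable] = active_F[of n] \<Delta>_adapted[of "Suc n", simplified]
  show ?thesis
    unfolding risk_def[abs_def] by measurable
qed

lemma stopped_cost_measurable [measurable]: "stopped_cost n \<in> borel_measurable M"
  unfolding stopped_cost_def[abs_def]
  by (intro borel_measurable_sum measurable_If stage_cost_measurable) auto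

lemma above_measurable [measurable]: "above n \<in> sets M"
  unfolding above_def by measurable

lemma lost_measurable [measurable]: "lost n \<in> sets M"
  unfolding lost_def by measurable

lemma enat_less_of_le: "enat n \<le> T x \<Longrightarrow> k < n \<Longrightarrow> enat k < T x"
  by (meson enat_ord_simps(2) less_le_trans)

lemma stopped_cost_eq: "enat n \<le> T x \<Longrightarrow> stopped_cost n x = cum_cost Tr Y n x"
  unfolding stopped_cost_def cum_cost_def One_nat_def sum.atLeast1_atMost_eq
  by (intro sum.cong refl) (auto simp: enat_less_of_le)

lemma stopped_cost_Suc:
  "stopped_cost (Suc n) x = (if enat n < T x then cum_cost Tr Y (Suc n) x else stopped_cost n x)"
  using stopped_cost_eq[of n x] by (auto simp: stopped_cost_def cum_cost_Suc)

lemma stopped_cost_after: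
  assumes "T x = enat m" "m \<le> n"
  shows "stopped_cost n x = cum_cost Tr Y m x"
  using assms(2) by (induction rule: dec_induct) (auto simp: assms(1) stopped_cost_eq stopped_cost_Suc)

text \<open>For finite \<open>T\<close> the stopped cost is eventually constant, and for infinite
  \<open>T\<close> it is the cumulative cost.\<close>

lemma final_above_iff: "final_above Tr Y T B x \<longleftrightarrow> (\<forall>\<^sub>F n in sequentially. B < stopped_cost n x)"
proof (cases "T x")
  case (enat m)
  have "\<forall>\<^sub>F n in sequentially. (B < stopped_cost n x) = (B < cum_cost Tr Y m x)"
    using eventually_ge_at_top[of m] by eventually_elim (simp add: stopped_cost_after[OF enat])
  from eventually_subst[OF this] show ?thesis
    by (simp add: final_above_def enat)
next
  case infinity
  then show ?thesis
    by (simp add: final_above_def stopped_cost_eq)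
qed

text \<open>All factors lie in \<open>(0, 1]\<close>, so the partial products decrease and are
  bounded below by 0. For infinite \<open>T\<close> they therefore converge and \<open>lim\<close>
  is a genuine limit; for finite \<open>T\<close> they are constant from \<open>T\<close>
  on.\<close>

lemma survival_prod_limit:
  assumes range: "\<forall>t\<ge>1. enat t \<le> T x \<longrightarrow> 0 \<le> \<Delta> t x \<and> \<Delta> t x < 1"
  shows "(\<lambda>n. \<Prod>k<n. 1 - risk k x) \<longlonglongrightarrow> survival_prod \<Delta> T x" (is "?p \<longlonglongrightarrow> _")
    and "survival_prod \<Delta> T x \<le> (\<Prod>k<n. 1 - risk k x)"
proof -
  have risk: "0 \<le> risk k x" "risk k x < 1" for k
    using range by (auto simp: risk_def eSuc_enat[symmetric] ileI1)
  have dec: "decseq ?p"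
    by (rule decseq_SucI) (use risk in \<open>auto intro!: mult_right_le_one_le prod_nonneg simp: less_imp_le\<close>)
  have eq: "?p n = (\<Prod>t = 1..n. 1 - \<Delta> t x)" if "enat n \<le> T x" for n
    unfolding One_nat_def prod.atLeast1_atMost_eq using that
    by (intro prod.cong refl) (auto simp: risk_def enat_less_of_le)
  show lim: "?p \<longlonglongrightarrow> survival_prod \<Delta> T x"
  proof (cases "T x")
    case (enat m)
    have "?p n = ?p m" if "m \<le> n" for n
      using that by (induction rule: dec_induct) (auto simp: risk_def enat)
    then have "\<forall>\<^sub>F n in sequentially. ?p n = survival_prod \<Delta> T x"
      using eq[of m] enat by (auto simp: survival_prod_def eventually_sequentially)
    then show ?thesis
      by (rule tendsto_eventually)
  next
    case infinity
    have "convergent ?p"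
      using dec risk by (intro Bseq_monoseq_convergent decseq_bounded[of _ 0])
        (auto intro!: prod_nonneg simp: less_imp_le decseq_imp_monoseq)
    then show ?thesis
      using eq infinity by (simp add: survival_prod_def convergent_LIMSEQ_iff)
  qed
  show "survival_prod \<Delta> T x \<le> ?p n"
    using decseq_ge[OF dec lim] .
qed

section \<open>From the treatment conditions to a survival process\<close>

text \<open>The stage condition is integrated against \<open>f\<close>. One proof serves both
  relations, since each is reflexive and is preserved by integration and by nonnegative
  factors.\<close>

lemma stage_loss:
  assumes rel: "rel = (\<le>) \<or> rel = (=)"
    and first: "AE x in M. first_stage_cond M Tr Y b \<Delta> rel x"
    and later: "\<forall>t\<ge>2. AE x in M. enat t \<le> T x \<longrightarrow> later_stage_cond M N Tr Y B b \<Delta> rel t x"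
    and f: "f \<in> borel_measurable (F n)" and f_nonneg: "\<And>x. 0 \<le> f x" and f_le: "\<And>x. f x \<le> K"
  shows "rel (\<integral>x. f x * indicator (lost n) x \<partial>M) (\<integral>x. f x * risk n x * indicator (above n) x \<partial>M)"
proof -
  have rel_integral: "rel (\<integral>x. g x \<partial>M) (\<integral>x. h x \<partial>M)"
    if "AE x in M. rel (g x) (h x)" "integrable M g" "integrable M h" for g h :: "'a \<Rightarrow> real"
    using rel that by (auto intro: integral_mono_AE integral_cong_AE)
  have rel_mult: "rel (c * u) (c * v)" if "rel u v" "0 \<le> c" for c u v :: real
    using rel that by (auto intro: mult_left_mono)
  have rel_refl: "rel u u" for u
    using rel by auto
  have risk_range: "AE x in M. 0 \<le> risk n x \<and> risk n x \<le> 1"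
    using \<Delta>_range by eventually_elim (auto simp: risk_def eSuc_enat[symmetric] ileI1 less_imp_le)
  have f_risk: "(\<lambda>x. f x * risk n x) \<in> borel_measurable (F n)"
    using f risk_F[of n] by measurable
  have f_risk_bound: "AE x in M. norm (f x * risk n x) \<le> K"
    using risk_range
  proof eventually_elim
    case (elim x)
    have "f x * risk n x \<le> K * 1"
      using elim f_nonneg f_le order_trans[OF f_nonneg f_le] by (intro mult_mono) auto
    then show ?case
      using elim f_nonneg[of x] by (simp add: abs_mult)
  qed
  define A where "A = {x \<in> space M. cum_cost Tr Y (Suc n) x \<le> b (Suc n) x}"
  define C where "C = {x \<in> space M. B < cum_cost Tr Y n x}"
  have [measurable]: "A \<in> sets M" "C \<in> sets M"
    unfolding A_def C_def by measurable
  \<comment> \<open>The indicator of \<open>active n\<close> is known at time \<open>n\<close>, so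
    its product with \<open>f\<close> is again a test function.\<close>
  have lost_eq: "f x * indicator (lost n) x = f x * indicator (active n) x * indicator (A \<inter> C) x" for x
    by (auto simp: lost_def active_def A_def C_def indicator_def)
  \<comment> \<open>Stopped and cumulative cost agree wherever \<open>risk n\<close> is
    nonzero.\<close>
  have above_eq: "f x * risk n x * indicator (above n) x = f x * risk n x * indicator C x" for x
    by (auto simp: above_def C_def risk_def indicator_def stopped_cost_eq less_imp_le)
  show ?thesis
  proof (cases "n = 0")
    case True
    \<comment> \<open>The cost before stage 1 is 0, which exceeds \<open>B\<close>.\<close>
    have C_space: "C = space M"
      using B_neg by (auto simp: C_def True cum_cost_def)
    have pos: "enat 0 < T x" if "x \<in> space M" for x
      using less_le_trans[OF zero_less_one T_ge_1[OF that]] by (simp add: zero_enat_def[symmetric])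
    have A_eq: "A = {x \<in> space M. stage_cost Tr Y 1 x \<le> b 1 x}"
      by (simp add: A_def True cum_cost_def)
    obtain x0 where x0: "x0 \<in> space M"
      using not_empty by auto
    have f_const: "f x = f x0" if "x \<in> space M" for x
      using F_0_const[OF _ that x0] f True by simp
    have "(\<integral>x. f x * indicator (lost n) x \<partial>M) = (\<integral>x. f x0 * indicator A x \<partial>M)"
      unfolding lost_eq using f_const pos C_space
      by (intro Bochner_Integration.integral_cong) (auto simp: active_def True indicator_def)
    \<comment> \<open>The probability is kept as the integral of a constant, to be compared
      pointwise with \<open>risk n x\<close>.\<close>
    also have "\<dots> = (\<integral>x. f x0 * prob A \<partial>M)"
      by (simp add: prob_space)
    finally have lost_int: "(\<integral>x. f x * indicator (lost n) x \<partial>M) = (\<integral>x. f x0 * prob A \<partial>M)" .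
    have above_int: "(\<integral>x. f x * risk n x * indicator (above n) x \<partial>M) = (\<integral>x. f x * risk n x \<partial>M)"
      using C_space by (intro Bochner_Integration.integral_cong) (auto simp: above_eq)
    show ?thesis
      unfolding lost_int above_int
    proof (rule rel_integral)
      show "AE x in M. rel (f x0 * prob A) (f x * risk n x)"
        using first AE_space
      proof eventually_elim
        case (elim x)
        then have "rel (prob A) (risk n x)"
          by (simp add: first_stage_cond_def A_eq risk_def True pos)
        then show ?case
          using rel_mult f_nonneg f_const[OF elim(2)] by metis
      qed
      show "integrable M (\<lambda>x. f x * risk n x)"
        using f_risk_bound measurable_F_imp[OF f_risk] by (rule integrable_const_bound)
    qed simp
  next
    case False
    have active_meas: "active n \<in> sets (F n)"
      using active_F[of n] by (simp add: active_def pred_def space_F)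
    have f_active: "(\<lambda>x. f x * indicator (active n) x) \<in> borel_measurable (F n)"
      using f active_meas by measurable
    have f_active_bound: "AE x in M. norm (f x * indicator (active n) x) \<le> K"
      using f_nonneg f_le order_trans[OF f_nonneg f_le] by (auto simp: indicator_def)
    note int_lost = integral_sigma_prob[OF f_active f_active_bound, of "A \<inter> C"]
    note int_above = integral_sigma_prob[OF f_risk f_risk_bound, of C]
    have later': "AE x in M. enat (Suc n) \<le> T x \<longrightarrow> later_stage_cond M N Tr Y B b \<Delta> rel (Suc n) x"
      using later False by simp
    have "rel (\<integral>x. f x * indicator (active n) x * sigma_prob M (F n) (A \<inter> C) x \<partial>M)
        (\<integral>x. f x * risk n x * sigma_prob M (F n) C x \<partial>M)"
    proof (rule rel_integral)
      have "AE x in M. 0 \<le> sigma_prob M (F n) (A \<inter> C) x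
          \<and> sigma_prob M (F n) (A \<inter> C) x \<le> sigma_prob M (F n) C x"
        by (rule sigma_prob_mono) auto
      then show "AE x in M. rel (f x * indicator (active n) x * sigma_prob M (F n) (A \<inter> C) x)
          (f x * risk n x * sigma_prob M (F n) C x)"
        using later' AE_space
      proof eventually_elim
        case (elim x)
        show ?case
        proof (cases "enat n < T x")
          case True
          define p where "p = sigma_prob M (F n) (A \<inter> C) x"
          define q where "q = sigma_prob M (F n) C x"
          have pq: "0 \<le> p" "p \<le> q"
            using elim(1) by (simp_all add: p_def q_def)
          have "later_stage_cond M N Tr Y B b \<Delta> rel (Suc n) x"
            using elim(2) True by (simp add: Suc_ile_eq)
          then have cond: "rel (p / q) (\<Delta> (Suc n) x)" if "q \<noteq> 0"
            using that unfolding later_stage_cond_def Let_def sigma_prob_given_def p_def q_def A_def C_def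
            by simp
          \<comment> \<open>Where \<open>q = 0\<close>, also \<open>p = 0\<close> by domination and
            both sides vanish; elsewhere the condition is multiplied by \<open>q\<close>.\<close>
          have "rel p (\<Delta> (Suc n) x * q)"
          proof (cases "q = 0")
            case True
            then have "p = 0"
              using pq by simp
            then show ?thesis
              using True rel_refl[of 0] by simp
          next
            case False
            then have "0 < q"
              using pq by simp
            then show ?thesis
              using rel cond[OF False] by (elim disjE) (simp_all add: pos_divide_le_eq divide_eq_eq)
          qed
          from rel_mult[OF this f_nonneg[of x]] show ?thesis
            using True elim(3) by (simp add: active_def risk_def p_def q_def mult.assoc)
        qed (simp add: active_def risk_def rel_refl)
      qed
    qed (simp_all add: int_lost(1) int_above(1))
    then show ?thesis
      unfolding lost_eq above_eq by (simp add: int_lost(2) int_above(2))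
  qed
qed

lemma survival_process:
  assumes c: "0 < c" and "AE x in M. c \<le> survival_prod \<Delta> T x"
    and "AE x in M. first_stage_cond M Tr Y b \<Delta> (\<le>) x"
    and "\<forall>t\<ge>2. AE x in M. enat t \<le> T x \<longrightarrow> later_stage_cond M N Tr Y B b \<Delta> (\<le>) t x"
  shows "survival_process M F above lost risk c"
proof
  show "subalgebra M (F n)" for n
    by (rule subalgebra_F)
  show "risk m \<in> borel_measurable (F n)" if "m \<le> n" for m n
    using risk_F that by (rule measurable_F_mono)
  show "above 0 = space M"
    using B_neg by (simp add: above_def stopped_cost_def)
  show "AE x in M. \<forall>n. 0 \<le> risk n x \<and> risk n x < 1"
    using \<Delta>_range by eventually_elim (auto simp: risk_def eSuc_enat[symmetric] ileI1)
  show "AE x in M. \<forall>n. c \<le> (\<Prod>k<n. 1 - risk k x)"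
    using assms(2) \<Delta>_range by eventually_elim (blast intro: order_trans survival_prod_limit(2))
  \<comment> \<open>An active stage without loss ends above \<open>b (Suc n) x \<ge> B\<close>; from
    \<open>T\<close> on the stopped cost does not move.\<close>
  show "AE x in M. \<forall>n. x \<in> above n \<longrightarrow> x \<notin> lost n \<longrightarrow> x \<in> above (Suc n)"
    using b_ge
  proof eventually_elim
    case (elim x)
    show ?case
    proof (intro allI impI)
      fix n
      assume "x \<in> above n" "x \<notin> lost n"
      then show "x \<in> above (Suc n)"
        using elim[rule_format, of "Suc n"]
        by (auto simp: above_def lost_def stopped_cost_Suc stopped_cost_eq Suc_ile_eq less_imp_le)
    qed
  qed
  show "(\<integral>x. f x * indicator (lost n) x \<partial>M) \<le> (\<integral>x. f x * risk n x * indicator (above n) x \<partial>M)"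
    if "f \<in> borel_measurable (F n)" "\<And>x. 0 \<le> f x" "\<And>x. f x \<le> K" for n f K
    using stage_loss[of "(\<le>)", OF _ assms(3,4) that] by simp
qed (rule above_measurable lost_measurable c)+

lemma exact_survival_process:
  assumes c: "0 < c" and prod: "AE x in M. survival_prod \<Delta> T x = c"
    and b_eq: "AE x in M. \<forall>t\<ge>1. enat t \<le> T x \<longrightarrow> b t x = B"
    and first: "AE x in M. first_stage_cond M Tr Y b \<Delta> (=) x"
    and later: "\<forall>t\<ge>2. AE x in M. enat t \<le> T x \<longrightarrow> later_stage_cond M N Tr Y B b \<Delta> (=) t x"
    and cost: "AE x in M. \<forall>t\<ge>1. enat t \<le> T x \<longrightarrow> stage_cost Tr Y t x \<le> 0"
  shows "exact_survival_process M F above lost risk c"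
proof -
  have "AE x in M. c \<le> survival_prod \<Delta> T x"
    using prod by eventually_elim simp
  moreover have "AE x in M. first_stage_cond M Tr Y b \<Delta> (\<le>) x"
    using first by eventually_elim (simp add: first_stage_cond_def)
  moreover have "\<forall>t\<ge>2. AE x in M. enat t \<le> T x \<longrightarrow> later_stage_cond M N Tr Y B b \<Delta> (\<le>) t x"
  proof (intro allI impI)
    fix t :: nat
    assume "t \<ge> 2"
    then have "AE x in M. enat t \<le> T x \<longrightarrow> later_stage_cond M N Tr Y B b \<Delta> (=) t x"
      using later by simp
    then show "AE x in M. enat t \<le> T x \<longrightarrow> later_stage_cond M N Tr Y B b \<Delta> (\<le>) t x"
      by eventually_elim (auto simp: later_stage_cond_def Let_def split: if_splits)
  qed
  ultimately interpret survival_process M F above lost risk c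
    using survival_process[OF c] by blast
  show ?thesis
  proof
    \<comment> \<open>With \<open>b = B\<close> a loss is exactly a crossing of \<open>B\<close>,
      and nonpositive costs rule out any recovery.\<close>
    show "AE x in M. \<forall>n. x \<in> above (Suc n) \<longleftrightarrow> x \<in> above n \<and> x \<notin> lost n"
      using b_eq cost
    proof eventually_elim
      case (elim x)
      show ?case
      proof
        fix n
        show "x \<in> above (Suc n) \<longleftrightarrow> x \<in> above n \<and> x \<notin> lost n"
          using elim(1)[rule_format, of "Suc n"] elim(2)[rule_format, of "Suc n"]
          by (auto simp: above_def lost_def stopped_cost_Suc stopped_cost_eq cum_cost_Suc Suc_ile_eq
              less_imp_le)
      qed
    qed
    show "lost n \<subseteq> above n" for n
      by (auto simp: above_def lost_def stopped_cost_eq less_imp_le)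
    show "(\<integral>x. f x * indicator (lost n) x \<partial>M) = (\<integral>x. f x * risk n x * indicator (above n) x \<partial>M)"
      if "f \<in> borel_measurable (F n)" "\<And>x. 0 \<le> f x" "\<And>x. f x \<le> K" for n f K
      using stage_loss[of "(=)", OF _ first later that] by simp
    show "AE x in M. (\<lambda>n. \<Prod>k<n. 1 - risk k x) \<longlonglongrightarrow> c"
      using prod \<Delta>_range by eventually_elim (metis survival_prod_limit(1))
  qed
qed

lemma survivors_eq: "survival_process.survivors M above = {x \<in> space M. final_above Tr Y T B x}"
  if "survival_process M F above lost risk c"
  by (auto simp: survival_process.survivors_def[OF that] above_def final_above_iff)

section \<open>Stages without treatment\<close>

text \<open>Without treatment \<open>r\<^sub>1 = 0 > b\<^sub>1\<close>, so the event in the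
  condition is null.\<close>

lemma first_stage_cond_no_treatment:
  assumes "AE x in M. Tr 1 x = {} \<and> b 1 x < 0"
  shows "AE x in M. first_stage_cond M Tr Y b \<Delta> (\<le>) x"
proof -
  have "AE x in M. \<not> stage_cost Tr Y 1 x \<le> b 1 x"
    using assms by eventually_elim (simp add: stage_cost_def)
  then have null: "prob {x \<in> space M. stage_cost Tr Y 1 x \<le> b 1 x} = 0"
    by (rule prob_Collect_eq_0[THEN iffD2, rotated])
      (use stage_cost_measurable[of 1] b_measurable[of 0] in simp)
  \<comment> \<open>Stage 1 always takes place because \<open>T \<ge> 1\<close>, hence its tolerance
    is nonnegative.\<close>
  show ?thesis
    using \<Delta>_range AE_space
    by eventually_elim (use T_ge_1 null in \<open>auto simp: first_stage_cond_def one_enat_def\<close>)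
qed

text \<open>Without treatment the cumulative cost does not change and so stays above the budget
  wherever it exceeded \<open>B\<close>. The set \<open>A\<close> localises the decision not to
  treat: as it is known at time \<open>t - 1\<close>, the conditional probability of overspending
  vanishes on it.\<close>

lemma later_stage_cond_no_treatment:
  assumes t: "t \<ge> 2" and A: "A \<in> sets (obs_filtration M N Tr Y (enat (t - 1)))"
    and none: "AE x in M. x \<in> A \<and> enat t \<le> T x \<longrightarrow>
      Tr t x = {} \<and> (cum_cost Tr Y (t - 1) x > B \<longrightarrow> b t x < cum_cost Tr Y (t - 1) x)"
  shows "AE x in M. x \<in> A \<and> enat t \<le> T x \<longrightarrow> later_stage_cond M N Tr Y B b \<Delta> (\<le>) t x"
proof -
  obtain n where n: "t = Suc n"
    using t by (cases t) auto
  define A' where "A' = {x \<in> space M. cum_cost Tr Y (Suc n) x \<le> b (Suc n) x}"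
  define C where "C = {x \<in> space M. B < cum_cost Tr Y n x}"
  have [measurable]: "A' \<in> sets M" "C \<in> sets M"
    unfolding A'_def C_def by measurable
  have "active n \<in> sets (F n)"
    using active_F[of n] by (simp add: active_def pred_def space_F)
  then have G: "A \<inter> active n \<in> sets (F n)"
    using A n by auto
  have "AE x in M. x \<in> A \<inter> active n \<longrightarrow> x \<notin> A' \<inter> C"
    using none
    by eventually_elim
       (auto simp: n A'_def C_def active_def cum_cost_Suc stage_cost_def Suc_ile_eq)
  then have "AE x in M. x \<in> A \<inter> active n \<longrightarrow> sigma_prob M (F n) (A' \<inter> C) x = 0"
    using G by (intro sigma_prob_eq_0) auto
  \<comment> \<open>Where the denominator is 0 the condition asks for an empty treatment group;
    elsewhere the quotient is 0 and the tolerance is nonnegative.\<close>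
  then show ?thesis
    using none \<Delta>_range AE_space
  proof eventually_elim
    case (elim x)
    then show ?case
      using t
      by (auto simp: n later_stage_cond_def Let_def sigma_prob_given_def A'_def C_def active_def
          Suc_ile_eq)
  qed
qed

end

theorem theorem3p1:
  fixes M :: "'a measure"
    and N :: "nat \<Rightarrow> 'i set"
    and Tr :: "nat \<Rightarrow> 'a \<Rightarrow> 'i set"
    and Y :: "'i \<Rightarrow> nat \<Rightarrow> nat \<Rightarrow> 'a \<Rightarrow> real"
    and B \<delta> :: real
    and T :: "'a \<Rightarrow> enat"
    and b \<Delta> :: "nat \<Rightarrow> 'a \<Rightarrow> real"
  assumes "phased_experiment M N Tr Y"
    and "B < 0" and "0 \<le> \<delta>" and "\<delta> < 1"
    and "stopping_time (obs_filtration M N Tr Y) T"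
    and "\<And>\<omega>. \<omega> \<in> space M \<Longrightarrow> T \<omega> \<ge> 1"
    and "\<And>t. t \<ge> 1 \<Longrightarrow> b t \<in> borel_measurable (obs_filtration M N Tr Y (enat (t - 1)))"
    and "\<And>t. t \<ge> 1 \<Longrightarrow> \<Delta> t \<in> borel_measurable (obs_filtration M N Tr Y (enat (t - 1)))"
    and "AE \<omega> in M. \<forall>t\<ge>1. enat t \<le> T \<omega> \<longrightarrow> b t \<omega> \<ge> B"
    and "AE \<omega> in M. \<forall>t\<ge>1. enat t \<le> T \<omega> \<longrightarrow> 0 \<le> \<Delta> t \<omega> \<and> \<Delta> t \<omega> < 1"
  shows
    "((AE \<omega> in M. 1 - survival_prod \<Delta> T \<omega> \<le> \<delta>) \<and>
      (AE \<omega> in M. first_stage_cond M Tr Y b \<Delta> (\<le>) \<omega>) \<and>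
      (\<forall>t\<ge>2. AE \<omega> in M. enat t \<le> T \<omega> \<longrightarrow> later_stage_cond M N Tr Y B b \<Delta> (\<le>) t \<omega>)
      \<longrightarrow> measure M {\<omega> \<in> space M. final_above Tr Y T B \<omega>} \<ge> 1 - \<delta>)
     \<and>
     ((AE \<omega> in M. \<forall>t\<ge>1. enat t \<le> T \<omega> \<longrightarrow> b t \<omega> = B) \<and>
      (AE \<omega> in M. 1 - survival_prod \<Delta> T \<omega> = \<delta>) \<and>
      (AE \<omega> in M. first_stage_cond M Tr Y b \<Delta> (=) \<omega>) \<and>
      (\<forall>t\<ge>2. AE \<omega> in M. enat t \<le> T \<omega> \<longrightarrow> later_stage_cond M N Tr Y B b \<Delta> (=) t \<omega>) \<and>
      (AE \<omega> in M. \<forall>t\<ge>1. enat t \<le> T \<omega> \<longrightarrow> stage_cost Tr Y t \<omega> \<le> 0)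
      \<longrightarrow> measure M {\<omega> \<in> space M. final_above Tr Y T B \<omega>} = 1 - \<delta>)
     \<and>
     ((AE \<omega> in M. Tr 1 \<omega> = {} \<and> b 1 \<omega> < 0)
      \<longrightarrow> (AE \<omega> in M. first_stage_cond M Tr Y b \<Delta> (\<le>) \<omega>))
     \<and>
     (\<forall>t\<ge>2. \<forall>A \<in> sets (obs_filtration M N Tr Y (enat (t - 1))).
        (AE \<omega> in M. \<omega> \<in> A \<and> enat t \<le> T \<omega> \<longrightarrow>
           Tr t \<omega> = {} \<and> (cum_cost Tr Y (t - 1) \<omega> > B \<longrightarrow> b t \<omega> < cum_cost Tr Y (t - 1) \<omega>))
        \<longrightarrow> (AE \<omega> in M. \<omega> \<in> A \<and> enat t \<le> T \<omega> \<longrightarrow>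
               later_stage_cond M N Tr Y B b \<Delta> (\<le>) t \<omega>))"
proof -
  interpret risk_experiment M N Tr Y B T b \<Delta>
    using assms by (intro risk_experiment.intro risk_experiment_axioms.intro)
  \<comment> \<open>The constant \<open>c\<close> of the survival process will be
    \<open>1 - \<delta>\<close>.\<close>
  have c: "0 < 1 - \<delta>"
    using \<open>\<delta> < 1\<close> by simp
  show ?thesis
  proof (intro conjI impI allI ballI; (elim conjE)?)
    assume prod: "AE \<omega> in M. 1 - survival_prod \<Delta> T \<omega> \<le> \<delta>"
      and first: "AE \<omega> in M. first_stage_cond M Tr Y b \<Delta> (\<le>) \<omega>"
      and later: "\<forall>t\<ge>2. AE \<omega> in M. enat t \<le> T \<omega> \<longrightarrow> later_stage_cond M N Tr Y B b \<Delta> (\<le>) t \<omega>"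
    have "AE \<omega> in M. 1 - \<delta> \<le> survival_prod \<Delta> T \<omega>"
      using prod by eventually_elim simp
    then have *: "survival_process M F above lost risk (1 - \<delta>)"
      using c first later by (intro survival_process)
    show "1 - \<delta> \<le> prob {\<omega> \<in> space M. final_above Tr Y T B \<omega>}"
      using survival_process.prob_survivors_ge[OF *] by (simp add: survivors_eq[OF *])
  next
    assume b_eq: "AE \<omega> in M. \<forall>t\<ge>1. enat t \<le> T \<omega> \<longrightarrow> b t \<omega> = B"
      and prod: "AE \<omega> in M. 1 - survival_prod \<Delta> T \<omega> = \<delta>"
      and first: "AE \<omega> in M. first_stage_cond M Tr Y b \<Delta> (=) \<omega>"
      and later: "\<forall>t\<ge>2. AE \<omega> in M. enat t \<le> T \<omega> \<longrightarrow> later_stage_cond M N Tr Y B b \<Delta> (=) t \<omega>"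
      and cost: "AE \<omega> in M. \<forall>t\<ge>1. enat t \<le> T \<omega> \<longrightarrow> stage_cost Tr Y t \<omega> \<le> 0"
    have "AE \<omega> in M. survival_prod \<Delta> T \<omega> = 1 - \<delta>"
      using prod by eventually_elim simp
    then have *: "exact_survival_process M F above lost risk (1 - \<delta>)"
      using c b_eq first later cost by (intro exact_survival_process)
    then have "survival_process M F above lost risk (1 - \<delta>)"
      by (rule exact_survival_process.axioms)
    then show "prob {\<omega> \<in> space M. final_above Tr Y T B \<omega>} = 1 - \<delta>"
      using exact_survival_process.prob_survivors_eq[OF *] by (simp add: survivors_eq)
  next
    assume "AE \<omega> in M. Tr 1 \<omega> = {} \<and> b 1 \<omega> < 0"
    then show "AE \<omega> in M. first_stage_cond M Tr Y b \<Delta> (\<le>) \<omega>"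
      by (rule first_stage_cond_no_treatment)
  next
    fix t :: nat and A
    assume "2 \<le> t" "A \<in> sets (obs_filtration M N Tr Y (enat (t - 1)))"
      and "AE \<omega> in M. \<omega> \<in> A \<and> enat t \<le> T \<omega> \<longrightarrow>
           Tr t \<omega> = {} \<and> (cum_cost Tr Y (t - 1) \<omega> > B \<longrightarrow> b t \<omega> < cum_cost Tr Y (t - 1) \<omega>)"
    then show "AE \<omega> in M. \<omega> \<in> A \<and> enat t \<le> T \<omega> \<longrightarrow> later_stage_cond M N Tr Y B b \<Delta> (\<le>) t \<omega>"
      by (rule later_stage_cond_no_treatment)
  qed
qed

end
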